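(* Let $\kappa\in(0,1)$, let $n>3$ be an integer and let $a=\frac{1}{2n}$. Let $\phi$ and $\psi$ be the functions, analytic near $0$, associated with $\kappa$ and $a$ as in the context, let $d=\cos\psi$ and let $D=d^2$. Then $D$ is not elliptic; that is, there is no elliptic function on $\mathbb{C}$ that agrees with $D$ on a neighbourhood of $0$.
   Context: For a number $a$ write $F_a(z)=F(\tfrac12-a,\tfrac12+a;\tfrac12;z)$, where $F={}_2F_1$ is the Gauss hypergeometric function (given by its power series for $|z|<1$). Fix $\kappa\in(0,1)$. Since $F_a(0)=1$, the map $\phi\mapsto\int_0^{\phi}F_a(\kappa^2\sin^2\theta)\,\mathrm{d}\theta$ is locally invertible near its fixed point $0$; write $\phi$ for the analytic local inverse, so that $\phi(0)=0$ and $t=\int_0^{\phi(t)}F_a(\kappa^2\sin^2\theta)\,\mathrm{d}\theta$ for $t$ near $0$. Let $\psi$ be the function analytic near $0$ determined by $\sin\psi=\kappa\sin\phi$ and $\psi(0)=0$. An elliptic function is a meromorphic function on $\mathbb{C}$ having two $\mathbb{R}$-linearly independent periods. *)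

theory Defs
  imports "HOL-Complex_Analysis.Complex_Analysis"
begin

text \<open>\<open>F(1/2 - a, 1/2 + a; 1/2; z)\<close> as the sum of its power series; only meaningful for
  \<open>norm z < 1\<close>.\<close>

definition hypergeo_F :: "complex \<Rightarrow> complex \<Rightarrow> complex" where
  "hypergeo_F a z = eval_fps (fps_hypergeo [1/2 - a, 1/2 + a] [1/2] 1) z"

text \<open>The integral runs along the straight segment from \<open>0\<close> to \<open>\<phi> t\<close>; near \<open>t = 0\<close> this segment
  lies in the disc around \<open>0\<close> where the integrand is holomorphic.  The conditions determine the
  germ of \<open>\<phi>\<close> at \<open>0\<close> uniquely, and constrain nothing beyond that germ.\<close>

definition is_local_inverse_phi :: "real \<Rightarrow> complex \<Rightarrow> (complex \<Rightarrow> complex) \<Rightarrow> bool" where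
  "is_local_inverse_phi \<kappa> a \<phi> \<longleftrightarrow>
     \<phi> analytic_on {0} \<and> \<phi> 0 = 0 \<and>
     (\<forall>\<^sub>F t in nhds 0.
        t = contour_integral (linepath 0 (\<phi> t)) (\<lambda>\<theta>. hypergeo_F a ((of_real \<kappa>)\<^sup>2 * (sin \<theta>)\<^sup>2)))"

definition is_associated_psi ::
    "real \<Rightarrow> (complex \<Rightarrow> complex) \<Rightarrow> (complex \<Rightarrow> complex) \<Rightarrow> bool" where
  "is_associated_psi \<kappa> \<phi> \<psi> \<longleftrightarrow>
     \<psi> analytic_on {0} \<and> \<psi> 0 = 0 \<and>
     (\<forall>\<^sub>F t in nhds 0. sin (\<psi> t) = of_real \<kappa> * sin (\<phi> t))"

text \<open>\<^const>\<open>nicely_meromorphic_on\<close> rather than \<^const>\<open>meromorphic_on\<close>: the latter allows arbitrary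
  values on a discrete set, for which pointwise periodicity would not be the right notion.  Here
  \<open>f\<close> is continuous away from its poles and takes the value \<open>0\<close> at poles, so pointwise
  periodicity is periodicity of the meromorphic function.  The set in \<^const>\<open>independent\<close> needs
  \<open>\<omega>\<^sub>1 \<noteq> \<omega>\<^sub>2\<close> separately, since it may collapse to a singleton.\<close>

definition elliptic :: "(complex \<Rightarrow> complex) \<Rightarrow> bool" where
  "elliptic f \<longleftrightarrow>
     f nicely_meromorphic_on UNIV \<and>
     (\<exists>\<omega>\<^sub>1 \<omega>\<^sub>2. \<omega>\<^sub>1 \<noteq> \<omega>\<^sub>2 \<and> independent {\<omega>\<^sub>1, \<omega>\<^sub>2} \<and>
        (\<forall>z. f (z + \<omega>\<^sub>1) = f z) \<and> (\<forall>z. f (z + \<omega>\<^sub>2) = f z))"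

end

theory Submission
  imports Defs
begin

text \<open>
  Why \<open>D = cos\<^sup>2 \<psi>\<close> is not elliptic.

  The hypergeometric function has a closed form: \<open>F\<^sub>a(sin\<^sup>2 \<psi>) cos \<psi> = cos (2a\<psi>)\<close>, because the left
  side satisfies the differential equation of the cosine (\<open>hypergeo_F_sin_squared\<close>).  It turns the
  implicit definition of \<open>\<phi>\<close> and \<open>\<psi>\<close> into \<open>\<psi>'\<^sup>2 cos\<^sup>2 (\<psi>/n) = \<kappa>\<^sup>2 - sin\<^sup>2 \<psi>\<close> (\<open>psi_ode\<close>).  With
  \<open>c = cos\<^sup>2 (\<psi>/n)\<close> this reads \<open>c D'\<^sup>2 = 4 D (1 - D) (D - 1 + \<kappa>\<^sup>2)\<close>.  On the other hand \<open>D = R(c)\<close>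
  for a polynomial \<open>R\<close> of degree \<open>n\<close>, by the multiple-angle formula (\<open>cos_multiple_squared_poly\<close>).
  Eliminating \<open>c\<close> yields an algebraic differential equation for \<open>D\<close> alone.

  Suppose that an elliptic function \<open>E\<close> agrees with \<open>D\<close> near \<open>0\<close>.  The equation then holds for \<open>E\<close>
  on the whole plane (\<open>meromorphic_eventually_zero\<close>).  Let \<open>E\<close> have a pole of order \<open>p\<close>.  By the equation
  for \<open>c\<close>, either \<open>p \<le> 2\<close> and \<open>c\<close> stays bounded, which is absurd because \<open>E = R(c)\<close>, or \<open>c\<close> has a
  pole of order \<open>p - 2\<close> and \<open>E = R(c)\<close> demands \<open>p = n(p - 2)\<close>, which is impossible for \<open>p \<ge> 3\<close>
  and \<open>n > 3\<close> (\<open>pole_order_obstruction\<close>).  So \<open>E\<close> has no poles and is constant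
  by Liouville's theorem (\<open>elliptic_without_poles_constant\<close>), but \<open>D\<close> is not constant near \<open>0\<close>.
\<close>

section \<open>The hypergeometric function at a squared sine\<close>

text \<open>The recurrence gives the ratio of consecutive coefficients as
  \<open>((k + 1/2)\<^sup>2 - a\<^sup>2) / ((k + 1/2) (k + 1))\<close>, which is bounded in \<open>k\<close>.  Comparison with a
  geometric series covers also those \<open>a\<close> for which the series terminates, where a ratio test would
  divide by zero.\<close>

lemma fps_hypergeo_conv_radius_pos:
  "fps_conv_radius (fps_hypergeo [1/2 - a, 1/2 + a] [1/2] (1::complex)) > 0"
proof -
  define F where "F = fps_hypergeo [1/2 - a, 1/2 + a] [1/2] (1::complex)"
  define C where "C = 1 + 2 * norm a ^ 2"
  have C: "C > 0" unfolding C_def by (simp add: add_pos_nonneg)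
  have bound: "norm (fps_nth F k) \<le> C ^ k" for k
  proof (induction k)
    case 0
    show ?case by (simp add: F_def)
  next
    case (Suc k)
    define m where "m = (of_nat k + 1/2 :: complex)"
    have m: "norm m = real k + 1/2"
      unfolding m_def by (metis (mono_tags, lifting) norm_of_real abs_of_nonneg of_real_add of_real_of_nat_eq
          of_real_divide of_real_1 of_real_numeral add_nonneg_nonneg of_nat_0_le_iff zero_le_divide_1_iff zero_le_numeral)
    have "norm ((1/2 - a + of_nat k) * (1/2 + a + of_nat k)) = norm (m^2 - a^2)"
      by (simp add: m_def power2_eq_square algebra_simps)
    also have "\<dots> \<le> (real k + 1/2)^2 + norm a ^ 2"
      using norm_triangle_ineq4[of "m^2" "a^2"] by (simp add: norm_power m)
    also have "\<dots> \<le> C * ((real k + 1/2) * (real k + 1))"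
    proof -
      have "norm a ^ 2 * 1 \<le> norm a ^ 2 * (2 * ((real k + 1/2) * (real k + 1)))"
        by (intro mult_left_mono) (auto simp: field_simps)
      moreover have "(real k + 1/2)^2 \<le> (real k + 1/2) * (real k + 1)"
        by (simp add: power2_eq_square)
      ultimately show ?thesis unfolding C_def by (simp add: algebra_simps)
    qed
    finally have le: "norm ((1/2 - a + of_nat k) * (1/2 + a + of_nat k)) \<le> C * ((real k + 1/2) * (real k + 1))" .
    have eq: "fps_nth F (Suc k) * (m * of_nat (Suc k)) =
        (1/2 - a + of_nat k) * (1/2 + a + of_nat k) * fps_nth F k"
    proof -
      have "m \<noteq> 0" using m by auto
      have "fps_nth F (Suc k) = (1/2 - a + of_nat k) * (1/2 + a + of_nat k) / (m * of_nat (Suc k)) * fps_nth F k"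
        unfolding F_def fps_hypergeo_rec m_def by (simp add: ac_simps del: of_nat_Suc)
      with \<open>m \<noteq> 0\<close> show ?thesis by (simp del: of_nat_Suc)
    qed
    have "norm (fps_nth F (Suc k)) * ((real k + 1/2) * (real k + 1)) =
        norm (fps_nth F (Suc k) * (m * of_nat (Suc k)))"
      by (simp only: norm_mult m norm_of_nat) simp
    also have "\<dots> \<le> C * ((real k + 1/2) * (real k + 1)) * C ^ k"
      unfolding eq norm_mult[of _ "fps_nth F k"] by (intro mult_mono le Suc.IH) (use C in auto)
    also have "\<dots> = C ^ Suc k * ((real k + 1/2) * (real k + 1))" by simp
    finally show ?case
      by (rule mult_right_le_imp_le) (auto intro!: mult_pos_pos)
  qed
  have "fps_conv_radius F \<ge> ereal (1 / C)"
    unfolding fps_conv_radius_def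
  proof (rule conv_radius_geI_ex')
    fix r :: real assume r: "0 < r" "ereal r < ereal (1 / C)"
    then have rC: "C * r < 1" using C by (simp add: field_simps)
    show "summable (\<lambda>n. fps_nth F n * of_real r ^ n)"
    proof (rule summable_comparison_test')
      show "summable (\<lambda>n. (C * r) ^ n)"
        by (rule summable_geometric) (use C r rC in auto)
      show "norm (fps_nth F n * of_real r ^ n) \<le> (C * r) ^ n" for n
        using bound[of n] r by (simp add: norm_mult norm_power power_mult_distrib mult_right_mono)
    qed
  qed
  moreover have "ereal (1 / C) > 0" using C by simp
  ultimately show ?thesis unfolding F_def by (meson less_le_trans)
qed

text \<open>Gauss's hypergeometric equation for these parameters, multiplied by \<open>4\<close> to clear
  denominators.\<close>

lemma fps_hypergeo_ode:
  fixes a :: complex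
  defines "F \<equiv> fps_hypergeo [1/2 - a, 1/2 + a] [1/2] 1"
  shows "4 * fps_X * (1 - fps_X) * fps_deriv (fps_deriv F) + (2 - 8 * fps_X) * fps_deriv F
           = fps_const (1 - 4 * a\<^sup>2) * F"
proof (rule fps_ext)
  fix k
  have rec: "fps_nth F (Suc k) * ((2 * of_nat k + 1) * (2 * of_nat k + 2)) =
        (1 - 2*a + 2 * of_nat k) * (1 + 2*a + 2 * of_nat k) * fps_nth F k" for k
  proof -
    have "(2 * of_nat k + 1 :: complex) = of_nat (2*k+1)" by simp
    also have "\<dots> \<noteq> 0" by (simp only: of_nat_eq_0_iff)
    finally have nz: "(2 * of_nat k + 1 :: complex) \<noteq> 0" "(1/2 + of_nat k :: complex) \<noteq> 0"
      by (auto simp: field_simps)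
    have "fps_nth F (Suc k) = (1/2 - a + of_nat k) * (1/2 + a + of_nat k) / ((1/2 + of_nat k) * of_nat (Suc k)) * fps_nth F k"
      unfolding F_def fps_hypergeo_rec by (simp add: ac_simps del: of_nat_Suc)
    then have "fps_nth F (Suc k) * ((1/2 + of_nat k) * of_nat (Suc k)) = (1/2 - a + of_nat k) * (1/2 + a + of_nat k) * fps_nth F k"
      using nz of_nat_neq_0[of k, where ?'a=complex] by (simp del: of_nat_Suc)
    then have "4 * (fps_nth F (Suc k) * ((1/2 + of_nat k) * of_nat (Suc k))) = 4 * ((1/2 - a + of_nat k) * (1/2 + a + of_nat k) * fps_nth F k)"
      by (rule arg_cong)
    then show ?thesis by (simp add: algebra_simps add_divide_distrib)
  qed
  have "fps_nth (4 * fps_X * (1 - fps_X) * fps_deriv (fps_deriv F) + (2 - 8 * fps_X) * fps_deriv F) k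
     = fps_nth (fps_const 4 * (fps_X * fps_deriv (fps_deriv F)) - fps_const 4 * (fps_X * (fps_X * fps_deriv (fps_deriv F)))
        + fps_const 2 * fps_deriv F - fps_const 8 * (fps_X * fps_deriv F)) k"
    by (rule arg_cong[where f = "\<lambda>f. fps_nth f k"]) (simp add: numeral_fps_const algebra_simps)
  also have "\<dots> = fps_nth F (Suc k) * ((2 * of_nat k + 1) * (2 * of_nat k + 2)) - 4 * of_nat k ^ 2 * fps_nth F k 
       - 4 * of_nat k * fps_nth F k"
    \<comment> \<open>multiplication by \<open>fps_X\<close> shifts by one or two places, so \<open>k = 0\<close> and \<open>k = 1\<close> are separate\<close>
    by (cases k; cases "k - 1") (auto simp: algebra_simps power2_eq_square)
  also have "\<dots> = (1 - 4 * a\<^sup>2) * fps_nth F k"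
    unfolding rec by (simp add: algebra_simps power2_eq_square)
  finally show "fps_nth (4 * fps_X * (1 - fps_X) * fps_deriv (fps_deriv F) + (2 - 8 * fps_X) * fps_deriv F) k
           = fps_nth (fps_const (1 - 4 * a\<^sup>2) * F) k" by simp
qed

lemma fps_cos_unique:
  fixes H :: "complex fps"
  assumes ode: "fps_deriv (fps_deriv H) = - fps_const (c\<^sup>2) * H"
    and init: "fps_nth H 0 = 1" "fps_nth H 1 = 0"
  shows "H = fps_cos c"
proof -
  have ode': "fps_deriv (fps_deriv (fps_cos c)) = - fps_const (c\<^sup>2) * fps_cos c"
    by (simp add: fps_cos_deriv fps_sin_deriv power2_eq_square flip: mult.assoc)
  have nth: "fps_nth G (Suc (Suc k)) = - c\<^sup>2 * fps_nth G k / (of_nat (Suc k) * of_nat (Suc (Suc k)))"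
    if "fps_deriv (fps_deriv G) = - fps_const (c\<^sup>2) * G" for G k
  proof -
    have "fps_nth (fps_deriv (fps_deriv G)) k = - c\<^sup>2 * fps_nth G k"
      unfolding that by simp
    then show ?thesis by (simp add: field_simps del: of_nat_Suc)
  qed
  have "fps_nth H k = fps_nth (fps_cos c) k \<and> fps_nth H (Suc k) = fps_nth (fps_cos c) (Suc k)" for k
    by (induction k) (use init nth[OF ode] nth[OF ode'] in \<open>auto simp: fps_cos_def\<close>)
  then show ?thesis by (auto intro: fps_ext)
qed

text \<open>The substitution \<open>z = sin\<^sup>2 \<psi>\<close> together with the factor \<open>cos \<psi>\<close> turns Gauss's equation into
  the oscillator equation \<open>H'' = - (2a)\<^sup>2 H\<close>.\<close>

lemma fps_hypergeo_compose_sin_squared: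
  fixes a :: complex
  shows "(fps_hypergeo [1/2 - a, 1/2 + a] [1/2] 1 oo (fps_sin 1)\<^sup>2) * fps_cos 1 = fps_cos (2 * a)"
proof (rule fps_cos_unique)
  define F where "F = fps_hypergeo [1/2 - a, 1/2 + a] [1/2] (1::complex)"
  define S C where "S = fps_sin (1::complex)" and "C = fps_cos (1::complex)"
  define Y Y1 Y2 where "Y = F oo S\<^sup>2" and "Y1 = fps_deriv F oo S\<^sup>2"
    and "Y2 = fps_deriv (fps_deriv F) oo S\<^sup>2"
  have S0: "fps_nth (S\<^sup>2) 0 = 0" by (simp add: S_def power2_eq_square)
  have CS: "C\<^sup>2 + S\<^sup>2 = 1"
    using fps_sin_cos_sum_of_squares[of "1::complex"] by (simp add: C_def S_def)
  have dS: "fps_deriv S = C" and dC: "fps_deriv C = - S"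
    by (simp_all add: S_def C_def fps_sin_deriv fps_cos_deriv flip: fps_const_neg)
  have dS2: "fps_deriv (S\<^sup>2) = 2 * S * C"
    by (simp add: power2_eq_square dS algebra_simps)
  have dY: "fps_deriv Y = Y1 * (2 * S * C)" and dY1: "fps_deriv Y1 = Y2 * (2 * S * C)"
    unfolding Y_def Y1_def Y2_def by (simp_all add: fps_compose_deriv[OF S0] dS2)
  have "(4 * fps_X * (1 - fps_X) * fps_deriv (fps_deriv F) + (2 - 8 * fps_X) * fps_deriv F) oo S\<^sup>2
          = (fps_const (1 - 4 * a\<^sup>2) * F) oo S\<^sup>2"
    using fps_hypergeo_ode[of a] unfolding F_def by simp
  then have ode: "4 * S\<^sup>2 * (1 - S\<^sup>2) * Y2 + (2 - 8 * S\<^sup>2) * Y1 = (1 - fps_const ((2 * a)\<^sup>2)) * Y"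
    unfolding Y_def Y1_def Y2_def
    by (simp add: fps_compose_add_distrib fps_compose_sub_distrib fps_compose_mult_distrib[OF S0] S0
        numeral_fps_const power_mult_distrib flip: fps_const_sub)
  have "fps_deriv (fps_deriv (Y * C)) =
     C * (4 * S\<^sup>2 * C\<^sup>2 * Y2 + (2 * C\<^sup>2 - 6 * S\<^sup>2) * Y1 - Y)"
    by (simp add: dY dY1 dS dC algebra_simps power2_eq_square)
  also have "\<dots> = - fps_const ((2 * a)\<^sup>2) * (Y * C)"
    using ode CS by algebra
  finally show "fps_deriv (fps_deriv ((F oo (fps_sin 1)\<^sup>2) * fps_cos 1)) =
    - fps_const ((2 * a)\<^sup>2) * ((F oo (fps_sin 1)\<^sup>2) * fps_cos 1)"
    unfolding Y_def S_def C_def .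
  show "fps_nth ((F oo (fps_sin 1)\<^sup>2) * fps_cos 1) 0 = 1"
    by (simp add: F_def fps_cos_def)
  have "fps_nth (fps_deriv (Y * C)) 0 = 0"
    by (simp add: dY dC S_def)
  then show "fps_nth ((F oo (fps_sin 1)\<^sup>2) * fps_cos 1) 1 = 0"
    unfolding Y_def S_def C_def by simp
qed

lemma hypergeo_F_has_fps_expansion:
  "hypergeo_F a has_fps_expansion fps_hypergeo [1/2 - a, 1/2 + a] [1/2] 1"
  unfolding has_fps_expansion_def hypergeo_F_def
  using fps_hypergeo_conv_radius_pos by simp

lemma hypergeo_F_sin_squared:
  "\<forall>\<^sub>F z in nhds 0. hypergeo_F a ((sin z)\<^sup>2) * cos z = cos (2 * a * z)"
proof -
  define F where "F = fps_hypergeo [1/2 - a, 1/2 + a] [1/2] (1::complex)"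
  have F: "hypergeo_F a has_fps_expansion F"
    unfolding F_def by (rule hypergeo_F_has_fps_expansion)
  have S: "(\<lambda>z. (sin z)\<^sup>2) has_fps_expansion (fps_sin (1::complex))\<^sup>2"
    by (intro fps_expansion_intros)
  have "(hypergeo_F a \<circ> (\<lambda>z. (sin z)\<^sup>2)) has_fps_expansion (F oo (fps_sin 1)\<^sup>2)"
    by (rule has_fps_expansion_compose[OF F S]) (simp add: power2_eq_square)
  from has_fps_expansion_mult[OF this has_fps_expansion_cos']
  have "(\<lambda>z. hypergeo_F a ((sin z)\<^sup>2) * cos z) has_fps_expansion fps_cos (2 * a)"
    unfolding F_def fps_hypergeo_compose_sin_squared by (simp add: o_def)
  moreover have "(\<lambda>z. cos (2 * a * z)) has_fps_expansion fps_cos (2 * a)"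
    by (rule has_fps_expansion_cos)
  ultimately have "\<forall>\<^sub>F z in nhds 0. eval_fps (fps_cos (2 * a)) z = hypergeo_F a ((sin z)\<^sup>2) * cos z"
    "\<forall>\<^sub>F z in nhds 0. eval_fps (fps_cos (2 * a)) z = cos (2 * a * z)"
    unfolding has_fps_expansion_def by blast+
  then show ?thesis by eventually_elim simp
qed

section \<open>The differential equation of \<open>\<psi>\<close>\<close>

lemma deriv_contour_integral_linepath:
  assumes "f analytic_on {z0}"
  shows "\<forall>\<^sub>F z in nhds z0. ((\<lambda>z. contour_integral (linepath z0 z) f) has_field_derivative f z) (at z)"
proof -
  obtain r where r: "r > 0" "f holomorphic_on ball z0 r"
    using assms by (auto simp: analytic_at_ball)
  obtain g where g: "\<And>z. z \<in> ball z0 r \<Longrightarrow> (g has_field_derivative f z) (at z within ball z0 r)"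
    using holomorphic_convex_primitive'[OF convex_ball open_ball r(2)] by blast
  have int: "contour_integral (linepath z0 z) f = g z - g z0" if "z \<in> ball z0 r" for z
  proof -
    have "closed_segment z0 z \<subseteq> ball z0 r"
      using that r(1) by (simp add: closed_segment_subset)
    then show ?thesis
      using contour_integral_primitive[OF g, of "linepath z0 z"]
      by (simp add: contour_integral_unique)
  qed
  have "((\<lambda>z. contour_integral (linepath z0 z) f) has_field_derivative f z) (at z)"
    if z: "z \<in> ball z0 r" for z
  proof (rule DERIV_cong_ev[THEN iffD2, OF refl _ refl])
    show "\<forall>\<^sub>F w in nhds z. contour_integral (linepath z0 w) f = g w - g z0"
      using eventually_nhds_in_open[OF open_ball z] by eventually_elim (rule int)
    show "((\<lambda>w. g w - g z0) has_field_derivative f z) (at z)"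
      using g[OF z] z by (auto intro!: derivative_eq_intros simp: at_within_open[OF z])
  qed
  then show ?thesis
    using eventually_nhds_in_open[of "ball z0 r" z0] r(1) by (auto elim: eventually_mono)
qed

lemma analytic_at_imp_eventually_DERIV:
  assumes "f analytic_on {z}"
  shows "\<forall>\<^sub>F w in nhds z. (f has_field_derivative deriv f w) (at w)"
proof -
  obtain S where S: "open S" "z \<in> S" "f holomorphic_on S"
    using assms unfolding analytic_at by blast
  then show ?thesis
    using eventually_nhds_in_open[OF S(1,2)] by (auto elim!: eventually_mono intro: holomorphic_derivI)
qed

lemma eventually_compose_analytic_at:
  assumes "\<forall>\<^sub>F w in nhds (f z). P w" "f analytic_on {z}"
  shows "\<forall>\<^sub>F w in nhds z. P (f w)"
proof -
  have "filterlim f (nhds (f z)) (nhds z)"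
    using analytic_at_imp_isCont[OF assms(2)] by (simp add: continuous_within tendsto_at_iff_tendsto_nhds)
  then show ?thesis using assms(1) by (simp add: filterlim_iff)
qed

lemma eventually_nhds_deriv_eq:
  assumes "\<forall>\<^sub>F t in nhds z. f t = g t"
    and "\<forall>\<^sub>F t in nhds z. (f has_field_derivative f' t) (at t)"
    and "\<forall>\<^sub>F t in nhds z. (g has_field_derivative g' t) (at t)"
  shows "\<forall>\<^sub>F t in nhds z. f' t = g' t"
proof -
  have "\<forall>\<^sub>F t in nhds z. \<forall>\<^sub>F t in nhds t. f t = g t"
    using assms(1) by (simp add: eventually_eventually)
  then show ?thesis
    using assms(2,3)
  proof eventually_elim
    case (elim t)
    have "(f has_field_derivative g' t) (at t)"
      using DERIV_cong_ev[THEN iffD2, OF refl elim(1) refl elim(3)] .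
    then show ?case using DERIV_unique elim(2) by blast
  qed
qed

text \<open>Differentiating the two implicit equations gives \<open>1 = F\<^sub>a(sin\<^sup>2 \<psi>) \<phi>'\<close> and
  \<open>cos \<psi> \<psi>' = \<kappa> cos \<phi> \<phi>'\<close>.  The closed form \<open>F\<^sub>a(sin\<^sup>2 \<psi>) cos \<psi> = cos (2a\<psi>)\<close> lets \<open>\<phi>'\<close> be
  eliminated, leaving \<open>cos (2a\<psi>) \<psi>' = \<kappa> cos \<phi>\<close>; squaring removes \<open>\<phi>\<close> as well.\<close>

lemma psi_ode:
  assumes phi: "is_local_inverse_phi \<kappa> a \<phi>" and psi: "is_associated_psi \<kappa> \<phi> \<psi>"
  shows "\<forall>\<^sub>F t in nhds 0. (deriv \<psi> t)\<^sup>2 * (cos (2 * a * \<psi> t))\<^sup>2 = (of_real \<kappa>)\<^sup>2 - (sin (\<psi> t))\<^sup>2"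
proof -
  define f where "f = (\<lambda>\<theta>. hypergeo_F a ((of_real \<kappa>)\<^sup>2 * (sin \<theta>)\<^sup>2))"
  have an: "\<phi> analytic_on {0}" "\<psi> analytic_on {0}" and zero: "\<phi> 0 = 0" "\<psi> 0 = 0"
    and inv: "\<forall>\<^sub>F t in nhds 0. t = contour_integral (linepath 0 (\<phi> t)) f"
    and sin: "\<forall>\<^sub>F t in nhds 0. sin (\<psi> t) = of_real \<kappa> * sin (\<phi> t)"
    using phi psi unfolding is_local_inverse_phi_def is_associated_psi_def f_def by auto
  have f: "f analytic_on {0}"
    unfolding f_def
    by (rule analytic_on_compose[unfolded o_def, where g = "hypergeo_F a"])
      (use has_fps_expansion_imp_analytic_0[OF hypergeo_F_has_fps_expansion] in
        \<open>auto intro!: analytic_intros\<close>)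
  have dphi: "\<forall>\<^sub>F t in nhds 0. (\<phi> has_field_derivative deriv \<phi> t) (at t)"
    and dpsi: "\<forall>\<^sub>F t in nhds 0. (\<psi> has_field_derivative deriv \<psi> t) (at t)"
    using an by (simp_all add: analytic_at_imp_eventually_DERIV)
  have int: "\<forall>\<^sub>F t in nhds 0. 1 = f (\<phi> t) * deriv \<phi> t"
  proof (rule eventually_nhds_deriv_eq[OF inv])
    have "\<forall>\<^sub>F z in nhds (\<phi> 0). ((\<lambda>z. contour_integral (linepath 0 z) f) has_field_derivative f z) (at z)"
      using deriv_contour_integral_linepath[OF f] by (simp add: zero)
    from eventually_compose_analytic_at[OF this an(1)] dphi
    show "\<forall>\<^sub>F t in nhds 0. ((\<lambda>t. contour_integral (linepath 0 (\<phi> t)) f)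
            has_field_derivative f (\<phi> t) * deriv \<phi> t) (at t)"
      by eventually_elim (rule DERIV_chain2)
  qed auto
  have sin': "\<forall>\<^sub>F t in nhds 0. cos (\<psi> t) * deriv \<psi> t = of_real \<kappa> * (cos (\<phi> t) * deriv \<phi> t)"
  proof (rule eventually_nhds_deriv_eq[OF sin])
    show "\<forall>\<^sub>F t in nhds 0. ((\<lambda>t. sin (\<psi> t)) has_field_derivative cos (\<psi> t) * deriv \<psi> t) (at t)"
      using dpsi by eventually_elim (auto intro!: derivative_eq_intros)
    show "\<forall>\<^sub>F t in nhds 0. ((\<lambda>t. of_real \<kappa> * sin (\<phi> t)) has_field_derivative
        of_real \<kappa> * (cos (\<phi> t) * deriv \<phi> t)) (at t)"
      using dphi by eventually_elim (auto intro!: derivative_eq_intros)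
  qed
  have "\<forall>\<^sub>F z in nhds (\<psi> 0). hypergeo_F a ((sin z)\<^sup>2) * cos z = cos (2 * a * z)"
    using hypergeo_F_sin_squared by (simp add: zero)
  note F = eventually_compose_analytic_at[OF this an(2)]
  have cos: "\<forall>\<^sub>F t in nhds 0. cos (\<psi> t) \<noteq> 0"
  proof (rule eventually_compose_analytic_at[OF _ an(2)])
    show "\<forall>\<^sub>F w in nhds (\<psi> 0). cos w \<noteq> 0"
      using eventually_nhds_in_open[of "{w. cos w \<noteq> (0::complex)}" "\<psi> 0"]
      by (simp add: zero open_Collect_neq continuous_intros)
  qed
  show ?thesis
    using int sin sin' F cos
  proof eventually_elim
    case (elim t)
    have "f (\<phi> t) = hypergeo_F a ((sin (\<psi> t))\<^sup>2)"
      unfolding f_def elim(2) by (simp add: power_mult_distrib)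
    with elim(1,4) have "cos (\<psi> t) = cos (2 * a * \<psi> t) * deriv \<phi> t"
      by (metis mult.assoc mult.commute mult_1)
    with elim(3) have "cos (\<psi> t) * (deriv \<psi> t * cos (2 * a * \<psi> t)) = cos (\<psi> t) * (of_real \<kappa> * cos (\<phi> t))"
      by algebra
    with elim(5) have "deriv \<psi> t * cos (2 * a * \<psi> t) = of_real \<kappa> * cos (\<phi> t)"
      by simp
    then have "(deriv \<psi> t)\<^sup>2 * (cos (2 * a * \<psi> t))\<^sup>2 = (of_real \<kappa>)\<^sup>2 * (cos (\<phi> t))\<^sup>2"
      by (metis power_mult_distrib)
    then show ?case
      unfolding elim(2) by (simp add: cos_squared_eq algebra_simps power_mult_distrib)
  qed
qed

section \<open>Multiple angles\<close>

text \<open>Chebyshev's recurrence, for \<open>cos (2kx)\<close> as a polynomial in \<open>cos\<^sup>2 x\<close>.  That the degree is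
  exactly \<open>n\<close> is what the comparison of pole orders needs.\<close>

lemma cos_multiple_squared_poly:
  assumes "n > 0"
  obtains R :: "complex poly" where "degree R = n"
    "\<And>x. (cos (of_nat n * x))\<^sup>2 = poly R ((cos x)\<^sup>2)"
proof -
  have "\<exists>T U :: complex poly. degree T = k \<and> degree U = Suc k \<and>
     (\<forall>x::complex. cos (2 * of_nat k * x) = poly T ((cos x)\<^sup>2)) \<and>
     (\<forall>x. cos (2 * of_nat (Suc k) * x) = poly U ((cos x)\<^sup>2))" for k
  proof (induction k)
    case 0
    show ?case
      by (rule exI[of _ 1], rule exI[of _ "[:-1, 2:]"]) (simp add: cos_double_cos)
  next
    case (Suc k)
    then obtain T U :: "complex poly" where deg: "degree T = k" "degree U = Suc k"
      and T: "\<And>x. cos (2 * of_nat k * x) = poly T ((cos x)\<^sup>2)"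
      and U: "\<And>x. cos (2 * of_nat (Suc k) * x) = poly U ((cos x)\<^sup>2)" by blast
    define V where "V = [:-2, 4:] * U + - T"
    have "degree ([:-2, 4:] * U) = Suc (Suc k)"
      using deg by (subst degree_mult_eq) auto
    then have "degree V = Suc (Suc k)"
      unfolding V_def using deg by (subst degree_add_eq_left) auto
    moreover have "cos (2 * of_nat (Suc (Suc k)) * x) = poly V ((cos x)\<^sup>2)" for x :: complex
    proof -
      define y where "y = 2 * of_nat (Suc k) * x"
      have "cos (y + 2 * x) + cos (y - 2 * x) = 2 * cos (2 * x) * cos y"
        by (simp add: cos_add cos_diff)
      then have "cos (2 * of_nat (Suc (Suc k)) * x) = 2 * cos (2 * x) * cos y - cos (2 * of_nat k * x)"
        by (simp add: y_def algebra_simps)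
      then show ?thesis
        unfolding V_def y_def U T cos_double_cos by (simp add: algebra_simps)
    qed
    ultimately show ?case using deg(2) U by blast
  qed
  then obtain T :: "complex poly" where T: "degree T = n" "\<And>x. cos (2 * of_nat n * x) = poly T ((cos x)\<^sup>2)"
    by meson
  show ?thesis
  proof
    show "degree (smult (1/2) (T + 1)) = n"
      using T(1) assms by (simp add: degree_add_eq_left)
    show "(cos (of_nat n * x))\<^sup>2 = poly (smult (1/2) (T + 1)) ((cos x)\<^sup>2)" for x
      using cos_double_cos[of "of_nat n * x"] T(2)[of x] by (simp add: algebra_simps)
  qed
qed

section \<open>Meromorphic and elliptic functions\<close>

text \<open>Liouville's theorem: an entire function takes all its values on the compact period
  parallelogram \<open>K\<close>.\<close>

lemma elliptic_without_poles_constant: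
  assumes "elliptic f" "\<And>z. \<not> is_pole f z"
  shows "f constant_on UNIV"
proof (rule Liouville_theorem)
  obtain w1 w2 where w: "w1 \<noteq> w2" "independent {w1, w2}" "\<And>z. f (z + w1) = f z" "\<And>z. f (z + w2) = f z"
    and f: "f nicely_meromorphic_on UNIV"
    using assms(1) unfolding elliptic_def by blast
  show hol: "f holomorphic_on UNIV"
    using nicely_meromorphic_without_singularities[OF f] assms(2)
    by (auto intro: analytic_imp_holomorphic)
  have per: "f (z + of_int k * w) = f z" if "\<And>z. f (z + w) = f z" for z w k
  proof -
    have nat: "f (z + of_nat k * w) = f z" for z k
    proof (induction k)
      case (Suc k)
      have "z + of_nat (Suc k) * w = (z + of_nat k * w) + w" by (simp add: algebra_simps)
      then show ?case using Suc that by metis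
    qed simp
    show ?thesis
    proof (cases "k \<ge> 0")
      case True
      then show ?thesis using nat[of z "nat k"] by simp
    next
      case False
      then show ?thesis using nat[of "z + of_int k * w" "nat (- k)"] by simp
    qed
  qed
  define K where "K = (\<lambda>(x, y). of_real x * w1 + of_real y * w2) ` ({0..1::real} \<times> {0..1::real})"
  have "compact K"
    unfolding K_def
    by (intro compact_continuous_image compact_Times) (auto simp: case_prod_unfold intro!: continuous_intros)
  then have "bounded (f ` K)"
    by (intro compact_imp_bounded compact_continuous_image)
      (auto intro: holomorphic_on_imp_continuous_on holomorphic_on_subset[OF hol])
  moreover have "range f \<subseteq> f ` K"
  proof safe
    fix z :: complex
    have "card {w1, w2} = DIM(complex)" using w(1) by simp
    then have "z \<in> span {w1, w2}"
      using w(2) by (metis UNIV_I card_eq_dim dim_UNIV finite.intros subset_UNIV subsetD)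
    then obtain x y :: real where z: "z = of_real x * w1 + of_real y * w2"
      by (auto simp: span_insert span_singleton scaleR_conv_of_real algebra_simps eq_diff_eq)
    define z' where "z' = of_real (frac x) * w1 + of_real (frac y) * w2"
    have "z = z' + of_int \<lfloor>x\<rfloor> * w1 + of_int \<lfloor>y\<rfloor> * w2"
      unfolding z z'_def frac_def by (simp add: algebra_simps)
    then have "f z = f z'" by (simp add: per w(3,4))
    moreover have "z' \<in> K"
      unfolding K_def z'_def by (rule image_eqI[of _ _ "(frac x, frac y)"]) (auto simp: frac_lt_1 less_imp_le)
    ultimately show "f z \<in> f ` K" by blast
  qed
  ultimately show "bounded (range f)" using bounded_subset by blast
qed

lemma meromorphic_eventually_zero:
  assumes f: "f meromorphic_on UNIV" and "\<forall>\<^sub>F z in at w. f z = 0"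
  shows "\<forall>\<^sub>F z in at z0. f z = 0"
proof -
  have "\<not> (\<forall>\<^sub>\<approx>z\<in>UNIV. f z \<noteq> 0)"
  proof
    assume "\<forall>\<^sub>\<approx>z\<in>UNIV. f z \<noteq> 0"
    then have "\<forall>\<^sub>F z in at w. f z \<noteq> 0" by (simp add: eventually_cosparse_open_eq)
    with assms(2) have "\<forall>\<^sub>F z in at w. False" by eventually_elim simp
    then show False by simp
  qed
  then have "\<forall>\<^sub>\<approx>z\<in>UNIV. f z = 0"
    using meromorphic_imp_constant_or_avoid[OF f, of 0] by auto
  then show ?thesis by (simp add: eventually_cosparse_open_eq)
qed

text \<open>Let \<open>p\<close> be the order of the pole of \<open>E\<close>, and call \<open>c\<close> the argument of \<open>R\<close>.  The numerator of \<open>c\<close>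
  has a pole of order \<open>3p\<close> and its denominator one of order \<open>2(p + 1)\<close>, so \<open>c\<close> behaves like
  \<open>(z - z0)\<close> to the power \<open>2 - p\<close>.  If \<open>p \<le> 2\<close>, then \<open>c\<close>, and hence \<open>E = R(c)\<close>, stays bounded.
  If \<open>p \<ge> 3\<close>, then \<open>R(c)\<close> has a pole of order \<open>n(p - 2)\<close>, where \<open>n\<close> is the degree of \<open>R\<close>, and
  this exceeds \<open>p\<close> as soon as \<open>n > 3\<close>.  The bound is sharp for this argument: \<open>n(p - 2) = p\<close> does
  have the solutions \<open>n = 3, p = 3\<close> and \<open>n = 2, p = 4\<close>.\<close>

lemma pole_order_obstruction:
  fixes E :: "complex \<Rightarrow> complex" and R :: "complex poly"
  assumes mero: "E meromorphic_on {z0}" and pole: "is_pole E z0" and deg: "degree R > 3"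
    and rel: "\<forall>\<^sub>F z in at z0. deriv E z \<noteq> 0 \<longrightarrow>
      E z = poly R (4 * E z * (1 - E z) * (E z - \<mu>) / (deriv E z)\<^sup>2)"
  shows False
proof -
  define n where "n = degree R"
  define p where "p = nat (- zorder E z0)"
  define g where "g = zor_poly E z0"
  obtain S where S: "open S" "z0 \<in> S" "E holomorphic_on S - {z0}"
    using mero analytic_imp_holomorphic
    unfolding meromorphic_at_iff isolated_singularity_at_def
    by (metis centre_in_ball open_ball)
  obtain r where p: "p > 0" and g0: "g z0 \<noteq> 0" and r: "r > 0" "g holomorphic_on cball z0 r"
    and E: "\<And>w. w \<in> cball z0 r - {z0} \<Longrightarrow> E w = g w / (w - z0) ^ p"
    using zorder_exist_pole[OF S(3,1,2) pole] unfolding g_def p_def by auto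
  \<comment> \<open>numerator of \<open>deriv E\<close> over \<open>(w - z0) ^ Suc p\<close>; at \<open>z0\<close> it equals \<open>- p g(z0)\<close>\<close>
  define h where "h = (\<lambda>w. deriv g w * (w - z0) - of_nat p * g w)"
  have g: "g holomorphic_on ball z0 r" using r(2) by (rule holomorphic_on_subset) auto
  have dE: "deriv E w = h w / (w - z0) ^ Suc p" if w: "w \<in> ball z0 r - {z0}" for w
  proof (rule DERIV_imp_deriv)
    have dg: "(g has_field_derivative deriv g w) (at w)"
      using g w by (auto intro: holomorphic_derivI)
    have "((\<lambda>w. g w / (w - z0) ^ p) has_field_derivative
        (deriv g w * (w - z0) ^ p - g w * (of_nat p * (w - z0) ^ (p - 1))) / ((w - z0) ^ p * (w - z0) ^ p)) (at w)"
      using w by (auto intro!: derivative_eq_intros dg)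
    also have "(deriv g w * (w - z0) ^ p - g w * (of_nat p * (w - z0) ^ (p - 1))) / ((w - z0) ^ p * (w - z0) ^ p)
       = h w / (w - z0) ^ Suc p"
    proof -
      define s where "s = w - z0"
      obtain k where k: "p = Suc k" using p by (cases p) auto
      have "s \<noteq> 0" using w by (simp add: s_def)
      then show ?thesis
        unfolding h_def s_def[symmetric] k by (simp add: divide_simps) (simp add: algebra_simps)
    qed
    finally show "(E has_field_derivative h w / (w - z0) ^ Suc p) (at w)"
    proof (rule DERIV_cong_ev[THEN iffD1, OF refl _ refl, rotated])
      show "\<forall>\<^sub>F w in nhds w. g w / (w - z0) ^ p = E w"
        using eventually_nhds_in_open[OF open_delete[OF open_ball] w]
        by eventually_elim (rule E[symmetric], auto)
    qed
  qed
  \<comment> \<open>\<open>c\<close> times \<open>(w - z0)\<close> to the power \<open>p - 2\<close>, in a form that makes sense at \<open>z0\<close>\<close>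
  define m where "m = (\<lambda>w. 4 * g w * ((w - z0) ^ p - g w) * (g w - \<mu> * (w - z0) ^ p) / (h w)\<^sup>2)"
  have contg: "isCont g z0" and contdg: "isCont (deriv g) z0"
    using g r(1) by (auto intro!: holomorphic_on_imp_continuous_on holomorphic_deriv
        simp: continuous_on_interior intro: continuous_on_interior)
  have h0: "h z0 \<noteq> 0" using p g0 by (simp add: h_def)
  have conth: "isCont h z0"
    unfolding h_def by (intro continuous_intros contg contdg)
  have contm: "isCont m z0"
    unfolding m_def using h0 by (intro continuous_intros contg conth) auto
  have m0: "m z0 \<noteq> 0" using p g0 h0 by (simp add: m_def power_0_left)
  have "\<forall>\<^sub>F w in at z0. h w \<noteq> 0"
    using conth h0 by (simp add: isCont_def tendsto_imp_eventually_ne)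
  moreover have "\<forall>\<^sub>F w in at z0. w \<in> ball z0 r - {z0}"
    using eventually_at_ball'[of r z0 UNIV] r(1) by auto
  ultimately have E_R: "\<forall>\<^sub>F w in at z0. w \<noteq> z0 \<and> E w = g w / (w - z0) ^ p \<and> 
      E w = poly R (m w * (w - z0) ^ 2 / (w - z0) ^ p)"
    using rel
  proof eventually_elim
    case (elim w)
    define s where "s = w - z0"
    have s: "s \<noteq> 0" using elim(2) by (simp add: s_def)
    have Ew: "E w = g w / s ^ p" using E[of w] elim(2) by (simp add: s_def)
    have d: "deriv E w = h w / s ^ Suc p" using dE[OF elim(2)] by (simp add: s_def)
    then have "deriv E w \<noteq> 0" using elim(1) s by simp
    moreover have "4 * E w * (1 - E w) * (E w - \<mu>) / (deriv E w)\<^sup>2 = m w * s ^ 2 / s ^ p"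
      unfolding Ew d m_def s_def[symmetric] using s elim(1)
      by (simp add: divide_simps power2_eq_square)
    ultimately show ?case using elim(2,3) Ew by (simp add: s_def)
  qed
  show False
  proof (cases "p \<le> 2")
    case True
    have "((\<lambda>w. poly R (m w * (w - z0) ^ (2 - p))) \<longlongrightarrow> poly R (m z0 * (z0 - z0) ^ (2 - p))) (at z0)"
      using isContD[OF contm] by (intro tendsto_intros)
    moreover have "\<forall>\<^sub>F w in at z0. poly R (m w * (w - z0) ^ (2 - p)) = E w"
      using E_R by eventually_elim (use True in \<open>auto simp: power_diff\<close>)
    ultimately have "(E \<longlongrightarrow> poly R (m z0 * (z0 - z0) ^ (2 - p))) (at z0)"
      by (rule Lim_transform_eventually)
    then show False using pole unfolding is_pole_def
      by (metis at_neq_bot not_tendsto_and_filterlim_at_infinity)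
  next
    case False
    define q where "q = p - 2"
    have q: "q > 0" "p = q + 2" using False by (auto simp: q_def)
    have "4 * q \<le> n * q" using deg by (simp add: n_def)
    then have nq: "p < n * q" using q by linarith
    \<comment> \<open>both sides of \<open>E = R(c)\<close>, multiplied by \<open>(w - z0) ^ (n * q)\<close>: the left side then vanishes
        at \<open>z0\<close>, while only the leading term survives on the right\<close>
    define L where "L = (\<lambda>w. g w * (w - z0) ^ (n * q - p))"
    define M where "M = (\<lambda>w. \<Sum>j\<le>n. coeff R j * m w ^ j * (w - z0) ^ ((n - j) * q))"
    have "\<forall>\<^sub>F w in at z0. L w = M w"
      using E_R
    proof eventually_elim
      case (elim w)
      define s where "s = w - z0"
      have s: "s \<noteq> 0" using elim by (simp add: s_def)
      have "L w = s ^ (n * q) * E w"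
        using elim nq s by (simp add: L_def s_def power_diff)
      also have "E w = poly R (m w / s ^ q)"
      proof -
        have "m w * s ^ 2 / s ^ p = m w / s ^ q"
          using s unfolding q(2) power_add by simp
        then show ?thesis using elim unfolding s_def by metis
      qed
      also have "s ^ (n * q) * \<dots> = M w"
        unfolding poly_altdef M_def sum_distrib_left n_def[symmetric] s_def[symmetric]
      proof (rule sum.cong)
        fix j assume j: "j \<in> {..n}"
        then have "s ^ (n * q) = s ^ ((n - j) * q) * (s ^ q) ^ j"
          by (simp add: diff_mult_distrib mult.commute[of j] flip: power_mult power_add)
        then show "s ^ (n * q) * (coeff R j * (m w / s ^ q) ^ j) = coeff R j * m w ^ j * s ^ ((n - j) * q)"
          using s by (simp add: power_divide)
      qed simp
      finally show ?case .
    qed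
    moreover have "(L \<longlongrightarrow> L z0) (at z0)"
      unfolding L_def by (intro tendsto_intros isContD[OF contg])
    ultimately have "(M \<longlongrightarrow> L z0) (at z0)" by (rule Lim_transform_eventually[rotated])
    moreover have "(M \<longlongrightarrow> M z0) (at z0)"
      unfolding M_def by (intro tendsto_intros isContD[OF contm])
    ultimately have "L z0 = M z0" by (metis at_neq_bot tendsto_unique)
    moreover have "L z0 = 0" using nq by (simp add: L_def)
    moreover have "M z0 = (\<Sum>j\<le>n. if j = n then coeff R n * m z0 ^ n else 0)"
      unfolding M_def by (rule sum.cong) (use q in auto)
    ultimately have "coeff R n * m z0 ^ n = 0" by simp
    then show False using m0 deg by (auto simp: n_def)
  qed
qed

section \<open>Non-ellipticity\<close>

theorem theorem8:
  fixes \<kappa> :: real and n :: nat and a :: complex and \<phi> \<psi> d D :: "complex \<Rightarrow> complex"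
  assumes "0 < \<kappa>" and "\<kappa> < 1"
    and "n > 3"
    and "a = 1 / (2 * of_nat n)"
    and "is_local_inverse_phi \<kappa> a \<phi>"
    and "is_associated_psi \<kappa> \<phi> \<psi>"
    and "\<forall>t. d t = cos (\<psi> t)"
    and "\<forall>t. D t = (d t)\<^sup>2"
  shows "\<not> (\<exists>E. elliptic E \<and> (\<forall>\<^sub>F t in nhds 0. E t = D t))"
proof
  assume "\<exists>E. elliptic E \<and> (\<forall>\<^sub>F t in nhds 0. E t = D t)"
  then obtain E where ell: "elliptic E" and ED: "\<forall>\<^sub>F t in nhds 0. E t = (cos (\<psi> t))\<^sup>2"
    using assms(7,8) by auto
  have mero: "E meromorphic_on UNIV"
    using ell unfolding elliptic_def nicely_meromorphic_on_def by blast
  define c where "c = (\<lambda>t. (cos (\<psi> t / of_nat n))\<^sup>2)"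
  define \<mu> where "\<mu> = 1 - (complex_of_real \<kappa>)\<^sup>2"
  have psi: "\<psi> analytic_on {0}" "\<psi> 0 = 0"
    using assms(6) unfolding is_associated_psi_def by auto
  have ode: "\<forall>\<^sub>F t in nhds 0. (deriv \<psi> t)\<^sup>2 * c t = (of_real \<kappa>)\<^sup>2 - (sin (\<psi> t))\<^sup>2"
    using psi_ode[OF assms(5,6)] by (simp add: assms(4) c_def mult.commute)
  have dpsi: "\<forall>\<^sub>F t in nhds 0. (\<psi> has_field_derivative deriv \<psi> t) (at t)"
    by (rule analytic_at_imp_eventually_DERIV[OF psi(1)])
  have dE: "\<forall>\<^sub>F t in nhds 0. deriv E t = - 2 * cos (\<psi> t) * sin (\<psi> t) * deriv \<psi> t"
  proof -
    have "\<forall>\<^sub>F t in nhds 0. \<forall>\<^sub>F t in nhds t. E t = (cos (\<psi> t))\<^sup>2"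
      using ED by (simp add: eventually_eventually)
    with dpsi show ?thesis
    proof eventually_elim
      case (elim t)
      have "((\<lambda>t. (cos (\<psi> t))\<^sup>2) has_field_derivative - 2 * cos (\<psi> t) * sin (\<psi> t) * deriv \<psi> t) (at t)"
        using elim(1) by (auto intro!: derivative_eq_intros)
      then show ?case
        using DERIV_imp_deriv deriv_cong_ev[OF elim(2) refl] by metis
    qed
  qed
  have c_E: "\<forall>\<^sub>F t in nhds 0. c t * (deriv E t)\<^sup>2 = 4 * E t * (1 - E t) * (E t - \<mu>)"
    using ode dE ED
  proof eventually_elim
    case (elim t)
    have "c t * (deriv E t)\<^sup>2 = 4 * (cos (\<psi> t))\<^sup>2 * (sin (\<psi> t))\<^sup>2 * ((deriv \<psi> t)\<^sup>2 * c t)"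
      unfolding elim(2) by (simp add: power2_eq_square)
    then show ?case
      unfolding elim(1,3) by (simp add: \<mu>_def sin_squared_eq)
  qed
  obtain R :: "complex poly" where R: "degree R = n"
    "\<And>x. (cos (of_nat n * x))\<^sup>2 = poly R ((cos x)\<^sup>2)"
    using cos_multiple_squared_poly[of n] assms(3) by auto
  have E_R: "\<forall>\<^sub>F t in nhds 0. E t = poly R (c t)"
    using ED
  proof eventually_elim
    case (elim t)
    show ?case
      using elim R(2)[of "\<psi> t / of_nat n"] assms(3) by (simp add: c_def)
  qed
  define V where "V = (\<lambda>t. 4 * E t * (1 - E t) * (E t - \<mu>))"
  \<comment> \<open>the relation \<open>E = R(V / (deriv E)\<^sup>2)\<close> with denominators cleared, so that it makes sense also
      where \<open>deriv E\<close> vanishes, as it does at \<open>0\<close>\<close>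
  define M where "M = (\<lambda>t. E t * deriv E t ^ (2 * n) - (\<Sum>j\<le>n. coeff R j * V t ^ j * deriv E t ^ (2 * (n - j))))"
  have split: "deriv E t ^ (2 * n) = (deriv E t ^ 2) ^ j * deriv E t ^ (2 * (n - j))" if "j \<le> n" for j t
    using that by (simp add: flip: power_mult power_add) (simp add: algebra_simps)
  have M_eq: "M t = (E t - poly R y) * deriv E t ^ (2 * n)" if "V t = y * (deriv E t)\<^sup>2" for y t
  proof -
    have "(\<Sum>j\<le>n. coeff R j * V t ^ j * deriv E t ^ (2 * (n - j))) = poly R y * deriv E t ^ (2 * n)"
      unfolding poly_altdef R(1) sum_distrib_right that
      by (rule sum.cong) (auto simp: split power_mult_distrib)
    then show ?thesis unfolding M_def by (simp add: algebra_simps)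
  qed
  have "\<forall>\<^sub>F t in nhds 0. M t = 0"
    using c_E E_R
  proof eventually_elim
    case (elim t)
    show ?case using M_eq[of t "c t"] elim(1) unfolding elim(2)[symmetric] V_def by simp
  qed
  then have "\<forall>\<^sub>F t in at 0. M t = 0"
    by (simp add: eventually_at_filter eventually_mono)
  moreover have "M meromorphic_on UNIV"
    unfolding M_def V_def by (intro meromorphic_intros mero)
  ultimately have M0: "\<forall>\<^sub>F t in at z. M t = 0" for z
    using meromorphic_eventually_zero by blast
  have no_pole: "\<not> is_pole E z" for z
  proof
    assume pole: "is_pole E z"
    show False
    proof (rule pole_order_obstruction[OF _ pole])
      show "E meromorphic_on {z}" using mero by (rule meromorphic_on_subset) simp
      show "degree R > 3" using R(1) assms(3) by simp
      show "\<forall>\<^sub>F t in at z. deriv E t \<noteq> 0 \<longrightarrow>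
        E t = poly R (4 * E t * (1 - E t) * (E t - \<mu>) / (deriv E t)\<^sup>2)"
        using M0[of z]
      proof eventually_elim
        case (elim t)
        then show ?case using M_eq[of t "V t / (deriv E t)\<^sup>2"] by (auto simp: V_def mult.assoc)
      qed
    qed
  qed
  \<comment> \<open>a constant \<open>E\<close> forces \<open>sin \<psi> = 0\<close> near \<open>0\<close>, whereas \<open>(deriv \<psi> 0)\<^sup>2 = \<kappa>\<^sup>2\<close>\<close>
  obtain e where "\<And>z. E z = e"
    using elliptic_without_poles_constant[OF ell no_pole] unfolding constant_on_def by auto
  moreover have "E 0 = 1"
    using eventually_nhds_x_imp_x[OF ED] psi(2) by simp
  ultimately have E1: "E t = 1" for t by simp
  have "\<forall>\<^sub>F t in nhds 0. sin (\<psi> t) = 0"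
    using ED by eventually_elim (simp add: E1 cos_squared_eq)
  then have "deriv (\<lambda>t. sin (\<psi> t)) 0 = 0"
    using deriv_cong_ev[of _ "\<lambda>_. 0"] by force
  moreover have "((\<lambda>t. sin (\<psi> t)) has_field_derivative deriv \<psi> 0) (at 0)"
    using eventually_nhds_x_imp_x[OF dpsi] psi(2) by (auto intro!: derivative_eq_intros)
  ultimately have "deriv \<psi> 0 = 0" by (simp add: DERIV_imp_deriv)
  then show False
    using eventually_nhds_x_imp_x[OF ode] psi(2) assms(1) by simp
qed

end
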